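(* Let $N$ be a supernatural number and let $\mathcal K$ be the algebra of compact operators on $\ell^2(\mathbb Z_{\ge0})$. If $d:\mathcal A(N)\to A(N)$ is a derivation, then $d$ maps $\mathcal A(N)\cap\mathcal K$ into $\mathcal K$.
   Context: A supernatural number is a formal product $N=\prod_{p\text{ prime}}p^{\epsilon_p}$ with $\epsilon_p\in\{0,1,\dots,\infty\}$ (finite or infinite). A positive integer $j$ divides $N$ ($j\mid N$) if for each prime $p$ the exponent of $p$ in $j$ is at most $\epsilon_p$. On $\ell^2(\mathbb Z_{\ge0})$ with canonical basis $\{E_k\}_{k\ge 0}$ let $UE_k=E_{k+1}$ be the unilateral shift, and for a bounded sequence $a(k)$ let $a(\mathbb K)E_k=a(k)E_k$. Let $\mathcal A_{\mathrm{diag,per}}(N)=\{a(\mathbb K): a \text{ is } j\text{-periodic for some positive integer } j\mid N\}$. $A(N)$ is the C$^*$-algebra of operators on $\ell^2(\mathbb Z_{\ge0})$ generated by $U$ and $\mathcal A_{\mathrm{diag,per}}(N)$; $\mathcal A(N)$ is the $^*$-subalgebra generated algebraically by $U,U^*$ and $\mathcal A_{\mathrm{diag,per}}(N)$. A derivation in $A(N)$ is a linear map $d:\mathcal A(N)\to A(N)$ with $d(ab)=d(a)b+a\,d(b)$ for all $a,b\in\mathcal A(N)$ (no continuity assumed). *)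

theory Defs
  imports "HOL-Analysis.Analysis" "HOL-Library.Extended_Nat"
    "HOL-Computational_Algebra.Primes"
begin

section \<open>The Hilbert space of square-summable complex sequences\<close>

typedef ell2 = "{x :: nat \<Rightarrow> complex. summable (\<lambda>n. (cmod (x n))\<^sup>2)}"
  morphisms coord Abs_ell2
  by (rule exI[of _ "\<lambda>_. 0"]) simp

setup_lifting type_definition_ell2

lemma summable_coord [simp]: "summable (\<lambda>n. (cmod (coord x n))\<^sup>2)"
  using coord[of x] by simp

lemma ell2_eqI: "(\<And>n. coord x n = coord y n) \<Longrightarrow> x = y"
proof -
  assume "\<And>n. coord x n = coord y n"
  then have "coord x = coord y" by (rule ext)
  then show ?thesis by (simp add: coord_inject)
qed

lemma square_summable_add:
  fixes x y :: "nat \<Rightarrow> complex"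
  assumes "summable (\<lambda>n. (cmod (x n))\<^sup>2)" "summable (\<lambda>n. (cmod (y n))\<^sup>2)"
  shows "summable (\<lambda>n. (cmod (x n + y n))\<^sup>2)"
proof (rule summable_comparison_test')
  show "summable (\<lambda>n. 2 * (cmod (x n))\<^sup>2 + 2 * (cmod (y n))\<^sup>2)"
    using assms by (intro summable_add summable_mult)
next
  fix n
  have "(cmod (x n + y n))\<^sup>2 \<le> (cmod (x n) + cmod (y n))\<^sup>2"
    by (intro power_mono norm_triangle_ineq) simp
  also have "\<dots> \<le> 2 * (cmod (x n))\<^sup>2 + 2 * (cmod (y n))\<^sup>2"
    using sum_squares_bound[of "cmod (x n)" "cmod (y n)"] by (simp add: power2_sum)
  finally show "norm ((cmod (x n + y n))\<^sup>2) \<le> 2 * (cmod (x n))\<^sup>2 + 2 * (cmod (y n))\<^sup>2"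
    by simp
qed

lemma square_summable_mult:
  fixes x a :: "nat \<Rightarrow> complex"
  assumes "summable (\<lambda>n. (cmod (x n))\<^sup>2)" "\<And>n. cmod (a n) \<le> C"
  shows "summable (\<lambda>n. (cmod (a n * x n))\<^sup>2)"
proof (rule summable_comparison_test')
  show "summable (\<lambda>n. C\<^sup>2 * (cmod (x n))\<^sup>2)"
    using assms by (intro summable_mult)
next
  fix n
  show "norm ((cmod (a n * x n))\<^sup>2) \<le> C\<^sup>2 * (cmod (x n))\<^sup>2"
    using assms(2)[of n]
    by (auto simp: norm_mult power_mult_distrib intro!: mult_right_mono power_mono)
qed

lemma summable_coord_mult: "summable (\<lambda>n. coord x n * cnj (coord y n))"
proof (rule summable_comparison_test')
  show "summable (\<lambda>n. (cmod (coord x n))\<^sup>2 + (cmod (coord y n))\<^sup>2)"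
    by (intro summable_add summable_coord)
next
  fix n
  have "2 * (cmod (coord x n) * cmod (coord y n))
      \<le> (cmod (coord x n))\<^sup>2 + (cmod (coord y n))\<^sup>2"
    using sum_squares_bound[of "cmod (coord x n)" "cmod (coord y n)"] by simp
  moreover have "0 \<le> cmod (coord x n) * cmod (coord y n)" by simp
  ultimately show "norm (coord x n * cnj (coord y n))
      \<le> (cmod (coord x n))\<^sup>2 + (cmod (coord y n))\<^sup>2"
    unfolding norm_mult complex_mod_cnj by linarith
qed

definition cinner :: "ell2 \<Rightarrow> ell2 \<Rightarrow> complex" where
  "cinner x y = (\<Sum>n. coord x n * cnj (coord y n))"

lemma cinner_sums: "(\<lambda>n. coord x n * cnj (coord y n)) sums cinner x y"
  unfolding cinner_def by (rule summable_sums[OF summable_coord_mult])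

lift_definition scale_vec :: "complex \<Rightarrow> ell2 \<Rightarrow> ell2" is "\<lambda>c x n. c * x n"
  by (rule square_summable_mult) auto

lemma coord_scale_vec [simp]: "coord (scale_vec c x) n = c * coord x n"
  by transfer simp

instantiation ell2 :: real_vector
begin

lift_definition zero_ell2 :: ell2 is "\<lambda>_. 0" by simp
lift_definition plus_ell2 :: "ell2 \<Rightarrow> ell2 \<Rightarrow> ell2" is "\<lambda>x y n. x n + y n"
  by (rule square_summable_add)
lift_definition uminus_ell2 :: "ell2 \<Rightarrow> ell2" is "\<lambda>x n. - x n" by simp
definition minus_ell2 :: "ell2 \<Rightarrow> ell2 \<Rightarrow> ell2" where "minus_ell2 x y = x + - y"
definition scaleR_ell2 :: "real \<Rightarrow> ell2 \<Rightarrow> ell2" where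
  "scaleR_ell2 r x = scale_vec (complex_of_real r) x"

lemma coord_zero [simp]: "coord 0 n = 0"
  by transfer simp

lemma coord_add [simp]: "coord (x + y) n = coord x n + coord y n"
  by transfer simp

lemma coord_uminus [simp]: "coord (- x) n = - coord x n"
  by transfer simp

lemma coord_diff [simp]: "coord (x - y) n = coord x n - coord y n"
  by (simp add: minus_ell2_def)

lemma coord_scaleR [simp]: "coord (r *\<^sub>R x) n = complex_of_real r * coord x n"
  by (simp add: scaleR_ell2_def)

instance
proof
  fix x y z :: ell2 and r s :: real
  show "x + y + z = x + (y + z)" by (rule ell2_eqI) simp
  show "x + y = y + x" by (rule ell2_eqI) simp
  show "0 + x = x" by (rule ell2_eqI) simp
  show "- x + x = 0" by (rule ell2_eqI) simp
  show "x - y = x + - y" by (rule minus_ell2_def)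
  show "r *\<^sub>R (x + y) = r *\<^sub>R x + r *\<^sub>R y" by (rule ell2_eqI) (simp add: distrib_left)
  show "(r + s) *\<^sub>R x = r *\<^sub>R x + s *\<^sub>R x" by (rule ell2_eqI) (simp add: distrib_right)
  show "r *\<^sub>R s *\<^sub>R x = (r * s) *\<^sub>R x" by (rule ell2_eqI) simp
  show "1 *\<^sub>R x = x" by (rule ell2_eqI) simp
qed

end

lemma cinner_add_left: "cinner (x + y) z = cinner x z + cinner y z"
proof (rule sums_unique2[OF cinner_sums])
  show "(\<lambda>n. coord (x + y) n * cnj (coord z n)) sums (cinner x z + cinner y z)"
    using sums_add[OF cinner_sums[of x z] cinner_sums[of y z]] by (simp add: distrib_right)
qed

lemma cinner_scale_left: "cinner (scale_vec c x) y = c * cinner x y"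
proof (rule sums_unique2[OF cinner_sums])
  show "(\<lambda>n. coord (scale_vec c x) n * cnj (coord y n)) sums (c * cinner x y)"
    using sums_mult[OF cinner_sums[of x y], of c] by (simp add: mult.assoc)
qed

lemma cinner_commute: "cinner x y = cnj (cinner y x)"
proof (rule sums_unique2[OF cinner_sums])
  have "(\<lambda>n. cnj (coord y n * cnj (coord x n))) sums cnj (cinner y x)"
    using cinner_sums[of y x] by (simp only: sums_cnj)
  then show "(\<lambda>n. coord x n * cnj (coord y n)) sums cnj (cinner y x)"
    by (simp add: mult.commute)
qed

lemma cinner_self: "cinner x x = complex_of_real (\<Sum>n. (cmod (coord x n))\<^sup>2)"
proof (rule sums_unique2[OF cinner_sums])
  have "(\<lambda>n. complex_of_real ((cmod (coord x n))\<^sup>2)) sums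
      complex_of_real (\<Sum>n. (cmod (coord x n))\<^sup>2)"
    by (intro sums_of_real summable_sums summable_coord)
  then show "(\<lambda>n. coord x n * cnj (coord x n)) sums
      complex_of_real (\<Sum>n. (cmod (coord x n))\<^sup>2)"
    by (simp only: complex_norm_square)
qed

instantiation ell2 :: real_inner
begin

definition inner_ell2 :: "ell2 \<Rightarrow> ell2 \<Rightarrow> real" where "inner_ell2 x y = Re (cinner x y)"
definition norm_ell2 :: "ell2 \<Rightarrow> real" where
  "norm_ell2 x = sqrt (\<Sum>n. (cmod (coord x n))\<^sup>2)"
definition sgn_ell2 :: "ell2 \<Rightarrow> ell2" where "sgn_ell2 x = x /\<^sub>R norm x"
definition dist_ell2 :: "ell2 \<Rightarrow> ell2 \<Rightarrow> real" where "dist_ell2 x y = norm (x - y)"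
definition uniformity_ell2 :: "(ell2 \<times> ell2) filter" where
  "uniformity_ell2 = (INF e\<in>{0<..}. principal {(x, y). dist x y < e})"
definition open_ell2 :: "ell2 set \<Rightarrow> bool" where
  "open_ell2 S \<longleftrightarrow> (\<forall>x\<in>S. \<forall>\<^sub>F (x', y) in uniformity. x' = x \<longrightarrow> y \<in> S)"

instance
proof
  fix x y z :: ell2 and r :: real
  show "dist x y = norm (x - y)" by (rule dist_ell2_def)
  show "sgn x = x /\<^sub>R norm x" by (rule sgn_ell2_def)
  show "uniformity = (INF e\<in>{0<..}. principal {(x :: ell2, y). dist x y < e})"
    by (rule uniformity_ell2_def)
  show "open S \<longleftrightarrow> (\<forall>x\<in>S. \<forall>\<^sub>F (x', y) in uniformity. x' = x \<longrightarrow> y \<in> S)" for S :: "ell2 set"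
    by (rule open_ell2_def)
  show "x \<bullet> y = y \<bullet> x" unfolding inner_ell2_def by (subst cinner_commute) simp
  show "(x + y) \<bullet> z = x \<bullet> z + y \<bullet> z" by (simp add: inner_ell2_def cinner_add_left)
  show "r *\<^sub>R x \<bullet> y = r * (x \<bullet> y)"
    by (simp add: inner_ell2_def scaleR_ell2_def cinner_scale_left)
  show "0 \<le> x \<bullet> x" by (simp add: inner_ell2_def cinner_self suminf_nonneg)
  show "x \<bullet> x = 0 \<longleftrightarrow> x = 0"
    by (auto simp: inner_ell2_def cinner_self suminf_eq_zero_iff intro!: ell2_eqI)
  show "norm x = sqrt (x \<bullet> x)" by (simp add: inner_ell2_def cinner_self norm_ell2_def)
qed

end

lemma norm_ell2_sq: "(norm x)\<^sup>2 = (\<Sum>n. (cmod (coord x n))\<^sup>2)" for x :: ell2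
  unfolding norm_ell2_def by (simp add: suminf_nonneg)

lemma norm_scale_vec: "norm (scale_vec c x) = cmod c * norm x"
  by (simp add: norm_ell2_def norm_mult power_mult_distrib suminf_mult real_sqrt_mult)

lift_definition basis_vec :: "nat \<Rightarrow> ell2" is "\<lambda>k n. if n = k then 1 else 0"
  by (rule summable_finite[of "{k}" for k]) auto

lemma coord_basis_vec [simp]: "coord (basis_vec k) n = (if n = k then 1 else 0)"
  by transfer simp


section \<open>Bounded operators\<close>

text \<open>The type \<open>ell2 \<Rightarrow>\<^sub>L ell2\<close> consists of the bounded \<^emph>\<open>real\<close>-linear maps with the
  operator norm; bounded operators on the complex Hilbert space are its complex-linear members.\<close>

type_synonym oper = "ell2 \<Rightarrow>\<^sub>L ell2"

definition bounded_operators :: "oper set" where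
  "bounded_operators = {T. \<forall>c x. blinfun_apply T (scale_vec c x) = scale_vec c (blinfun_apply T x)}"

lemma bounded_linear_scale_vec: "bounded_linear (scale_vec c)"
  by (rule bounded_linear_intro[where K = "cmod c"])
     (auto intro!: ell2_eqI simp: algebra_simps norm_scale_vec)

definition scale_op :: "complex \<Rightarrow> oper \<Rightarrow> oper" where
  "scale_op c T = Blinfun (scale_vec c) o\<^sub>L T"

lemma scale_op_apply: "blinfun_apply (scale_op c T) x = scale_vec c (blinfun_apply T x)"
  by (simp add: scale_op_def bounded_linear_Blinfun_apply bounded_linear_scale_vec)

text \<open>The defining equation determines \<open>S\<close> uniquely; for complex-linear \<open>T\<close> it exists
  (lemma \<open>cinner_adj\<close> below).\<close>

definition adj :: "oper \<Rightarrow> oper" where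
  "adj T = (THE S. \<forall>x y. cinner (blinfun_apply T x) y = cinner x (blinfun_apply S y))"

definition compact_operators :: "oper set" where
  "compact_operators = {T \<in> bounded_operators. compact (closure (blinfun_apply T ` cball 0 1))}"

definition star_subalgebra :: "oper set \<Rightarrow> bool" where
  "star_subalgebra A \<longleftrightarrow> A \<subseteq> bounded_operators \<and> 0 \<in> A \<and>
     (\<forall>S\<in>A. \<forall>T\<in>A. S + T \<in> A) \<and> (\<forall>c. \<forall>T\<in>A. scale_op c T \<in> A) \<and>
     (\<forall>S\<in>A. \<forall>T\<in>A. S o\<^sub>L T \<in> A) \<and> (\<forall>T\<in>A. adj T \<in> A)"

definition cstar_subalgebra :: "oper set \<Rightarrow> bool" where
  "cstar_subalgebra A \<longleftrightarrow> star_subalgebra A \<and> closed A"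


section \<open>The shift and the diagonal operators\<close>

lemma shift_seq_sums:
  assumes "summable (\<lambda>n. (cmod (x n))\<^sup>2)"
  shows "(\<lambda>n. (cmod (case n of 0 \<Rightarrow> 0 | Suc m \<Rightarrow> x m))\<^sup>2) sums (\<Sum>n. (cmod (x n))\<^sup>2)"
  using sums_Suc[of "\<lambda>n. (cmod (case n of 0 \<Rightarrow> 0 | Suc m \<Rightarrow> x m))\<^sup>2" "\<Sum>n. (cmod (x n))\<^sup>2"]
    summable_sums[OF assms] by simp

lift_definition shift_vec :: "ell2 \<Rightarrow> ell2" is "\<lambda>x n. case n of 0 \<Rightarrow> 0 | Suc m \<Rightarrow> x m"
  using shift_seq_sums by (blast intro: sums_summable)

lemma coord_shift_vec: "coord (shift_vec x) n = (case n of 0 \<Rightarrow> 0 | Suc m \<Rightarrow> coord x m)"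
  by transfer simp

lift_definition shift :: oper is shift_vec
proof (rule bounded_linear_intro[where K = 1])
  fix x y :: ell2 and r :: real
  show "shift_vec (x + y) = shift_vec x + shift_vec y"
    by (rule ell2_eqI) (simp add: coord_shift_vec split: nat.split)
  show "shift_vec (r *\<^sub>R x) = r *\<^sub>R shift_vec x"
    by (rule ell2_eqI) (simp add: coord_shift_vec split: nat.split)
  show "norm (shift_vec x) \<le> norm x * 1"
    using shift_seq_sums[OF summable_coord[of x]]
    by (simp add: norm_ell2_def coord_shift_vec sums_iff)
qed

text \<open>The junk value \<open>0\<close> is taken for unbounded \<open>a\<close>.\<close>

lift_definition diag_vec :: "(nat \<Rightarrow> complex) \<Rightarrow> ell2 \<Rightarrow> ell2" is
  "\<lambda>a x n. if bounded (range a) then a n * x n else 0"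
proof -
  fix a x :: "nat \<Rightarrow> complex"
  assume x: "summable (\<lambda>n. (cmod (x n))\<^sup>2)"
  show "summable (\<lambda>n. (cmod (if bounded (range a) then a n * x n else 0))\<^sup>2)"
  proof (cases "bounded (range a)")
    case True
    then obtain C where "\<And>n. cmod (a n) \<le> C" by (auto simp: bounded_iff)
    from square_summable_mult[OF x this] True show ?thesis by simp
  qed simp
qed

lemma coord_diag_vec:
  "coord (diag_vec a x) n = (if bounded (range a) then a n * coord x n else 0)"
  by transfer simp

lift_definition diag_op :: "(nat \<Rightarrow> complex) \<Rightarrow> oper" is diag_vec
proof (cases)
  fix a :: "nat \<Rightarrow> complex"
  assume "bounded (range a)"
  then obtain C where C: "\<And>n. cmod (a n) \<le> C" by (auto simp: bounded_iff)
  have C0: "0 \<le> C" using C[of 0] norm_ge_zero order_trans by blast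
  show "bounded_linear (diag_vec a)"
  proof (rule bounded_linear_intro[where K = C])
    fix x y :: ell2 and r :: real
    show "diag_vec a (x + y) = diag_vec a x + diag_vec a y"
      by (rule ell2_eqI) (simp add: coord_diag_vec algebra_simps)
    show "diag_vec a (r *\<^sub>R x) = r *\<^sub>R diag_vec a x"
      by (rule ell2_eqI) (simp add: coord_diag_vec algebra_simps)
    have "(norm (diag_vec a x))\<^sup>2 \<le> (\<Sum>n. C\<^sup>2 * (cmod (coord x n))\<^sup>2)"
      unfolding norm_ell2_sq
    proof (rule suminf_le)
      fix n
      show "(cmod (coord (diag_vec a x) n))\<^sup>2 \<le> C\<^sup>2 * (cmod (coord x n))\<^sup>2"
        using C[of n] by (auto simp: coord_diag_vec norm_mult power_mult_distrib
            intro!: mult_right_mono power_mono)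
    qed (auto intro: summable_mult)
    also have "\<dots> = (norm x * C)\<^sup>2"
      by (simp add: suminf_mult norm_ell2_sq power_mult_distrib)
    finally show "norm (diag_vec a x) \<le> norm x * C"
      by (rule power2_le_imp_le) (simp add: C0)
  qed
next
  fix a :: "nat \<Rightarrow> complex"
  assume "\<not> bounded (range a)"
  then have "diag_vec a = (\<lambda>x. 0)"
    by (intro ext ell2_eqI) (simp add: coord_diag_vec)
  then show "bounded_linear (diag_vec a)" by simp
qed

lemma shift_basis_vec: "blinfun_apply shift (basis_vec k) = basis_vec (Suc k)"
  by (rule ell2_eqI) (simp add: shift.rep_eq coord_shift_vec split: nat.split)

lemma diag_op_basis_vec:
  "bounded (range a) \<Longrightarrow> blinfun_apply (diag_op a) (basis_vec k) = scale_vec (a k) (basis_vec k)"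
  by (rule ell2_eqI) (simp add: diag_op.rep_eq coord_diag_vec)

lemma shift_in_bounded_operators: "shift \<in> bounded_operators"
  by (auto simp: bounded_operators_def shift.rep_eq coord_shift_vec intro!: ell2_eqI
      split: nat.split)

lemma diag_op_in_bounded_operators: "diag_op a \<in> bounded_operators"
  by (auto simp: bounded_operators_def diag_op.rep_eq coord_diag_vec intro!: ell2_eqI)


section \<open>Existence of adjoints\<close>

lemma cinner_basis_vec_right: "cinner x (basis_vec n) = coord x n"
proof -
  have "(\<lambda>m. coord x m * cnj (coord (basis_vec n) m)) = (\<lambda>m. if m = n then coord x m else 0)"
    by auto
  then show ?thesis
    using cinner_sums[of x "basis_vec n"] sums_single[of n "coord x"] sums_unique2 by metis
qed

lemma cinner_ext: "(\<And>x. cinner x y = cinner x z) \<Longrightarrow> y = z"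
  by (rule ell2_eqI) (metis cinner_basis_vec_right cinner_commute)

lemma cinner_scale_right: "cinner x (scale_vec c y) = cnj c * cinner x y"
  by (metis cinner_commute cinner_scale_left complex_cnj_mult)

lemma cinner_Cauchy_Schwarz: "cmod (cinner x y) \<le> norm x * norm y"
proof (cases "cinner x y = 0")
  case False
  define u where "u = cnj (cinner x y) / complex_of_real (cmod (cinner x y))"
  have "cinner (scale_vec u x) y = complex_of_real (cmod (cinner x y))"
    using False complex_norm_square[of "cinner x y"]
    by (simp add: cinner_scale_left u_def field_simps power2_eq_square)
  then have "cmod (cinner x y) = inner (scale_vec u x) y"
    by (simp add: inner_ell2_def)
  also have "\<dots> \<le> norm (scale_vec u x) * norm y"
    by (rule norm_cauchy_schwarz)
  also have "norm (scale_vec u x) = norm x"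
    using False by (simp add: norm_scale_vec u_def norm_divide)
  finally show ?thesis .
qed simp

lift_definition trunc :: "nat \<Rightarrow> (nat \<Rightarrow> complex) \<Rightarrow> ell2" is "\<lambda>k x n. if n < k then x n else 0"
  by (rule summable_finite[of "{..<k}" for k]) auto

lemma coord_trunc [simp]: "coord (trunc k x) n = (if n < k then x n else 0)"
  by transfer simp

lemma trunc_Suc: "trunc (Suc k) x = trunc k x + scale_vec (x k) (basis_vec k)"
  by (rule ell2_eqI) (auto simp: less_Suc_eq)

lemma norm_trunc_sq: "(norm (trunc k x))\<^sup>2 = (\<Sum>n<k. (cmod (x n))\<^sup>2)"
proof -
  have "(\<Sum>n. (cmod (coord (trunc k x) n))\<^sup>2) = (\<Sum>n<k. (cmod (coord (trunc k x) n))\<^sup>2)"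
    by (rule suminf_finite) auto
  then show ?thesis by (simp add: norm_ell2_sq)
qed

lemma trunc_tendsto: "(\<lambda>k. trunc k (coord x)) \<longlonglongrightarrow> x"
proof -
  have eq: "(norm (trunc k (coord x) - x))\<^sup>2 = (\<Sum>n. (cmod (coord x (n + k)))\<^sup>2)" for k
  proof -
    have s: "summable (\<lambda>n. (cmod (coord (trunc k (coord x) - x) n))\<^sup>2)" by (rule summable_coord)
    have "(\<Sum>n<k. (cmod (coord (trunc k (coord x) - x) n))\<^sup>2) = 0" by simp
    with suminf_split_initial_segment[OF s, of k] show ?thesis
      by (simp add: norm_ell2_sq del: coord_diff) simp
  qed
  have "(\<lambda>k. \<Sum>n. (cmod (coord x (n + k)))\<^sup>2) \<longlonglongrightarrow> 0"
    by (rule suminf_exist_split2[OF summable_coord])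
  then have "(\<lambda>k. (norm (trunc k (coord x) - x))\<^sup>2) \<longlonglongrightarrow> 0" by (simp only: eq)
  then have "(\<lambda>k. sqrt ((norm (trunc k (coord x) - x))\<^sup>2)) \<longlonglongrightarrow> sqrt 0"
    by (rule tendsto_real_sqrt)
  then have "(\<lambda>k. norm (trunc k (coord x) - x)) \<longlonglongrightarrow> 0" by simp
  then show ?thesis using LIM_zero_cancel tendsto_norm_zero_iff by blast
qed

lemma adjoint_exists:
  assumes T: "T \<in> bounded_operators"
  shows "\<exists>S. \<forall>x y. cinner (blinfun_apply T x) y = cinner x (blinfun_apply S y)"
proof -
  have scale: "blinfun_apply T (scale_vec c x) = scale_vec c (blinfun_apply T x)" for c x
    using T by (simp add: bounded_operators_def)
  define w where "w y n = cinner y (blinfun_apply T (basis_vec n))" for y n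
  have trunc: "cinner (blinfun_apply T (trunc k x)) y = (\<Sum>n<k. x n * cnj (w y n))" for k x y
  proof (induction k)
    case 0
    have "trunc 0 x = 0" by (rule ell2_eqI) simp
    then show ?case by (simp add: cinner_def)
  next
    case (Suc k)
    then show ?case
      by (simp add: trunc_Suc blinfun.add_right cinner_add_left scale cinner_scale_left w_def
          cinner_commute[symmetric])
  qed
  have bound: "(\<Sum>n<k. (cmod (w y n))\<^sup>2) \<le> (norm T * norm y)\<^sup>2" for y k
  proof -
    let ?s = "\<Sum>n<k. (cmod (w y n))\<^sup>2" and ?t = "trunc k (w y)"
    have "complex_of_real ?s = cinner (blinfun_apply T ?t) y"
      by (simp add: trunc complex_norm_square del: of_real_power)
    moreover have "0 \<le> ?s" by (intro sum_nonneg) simp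
    ultimately have "?s = cmod (cinner (blinfun_apply T ?t) y)"
      by (metis abs_of_nonneg norm_of_real)
    also have "\<dots> \<le> norm (blinfun_apply T ?t) * norm y" by (rule cinner_Cauchy_Schwarz)
    also have "\<dots> \<le> norm T * norm ?t * norm y"
      by (intro mult_right_mono norm_blinfun) simp
    finally have le: "norm ?t * norm ?t \<le> (norm T * norm y) * norm ?t"
      using norm_trunc_sq[of k "w y"] by (simp add: power2_eq_square algebra_simps)
    have "norm ?t \<le> norm T * norm y"
    proof (cases "norm ?t = 0")
      case False
      then have "0 < norm ?t" by simp
      with le show ?thesis by (rule mult_right_le_imp_le)
    qed simp
    then have "(norm ?t)\<^sup>2 \<le> (norm T * norm y)\<^sup>2" by (rule power_mono) simp
    then show ?thesis by (simp add: norm_trunc_sq)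
  qed
  have summ: "summable (\<lambda>n. (cmod (w y n))\<^sup>2)" for y
    using bound by (intro summableI_nonneg_bounded) auto
  define S where "S y = Abs_ell2 (w y)" for y
  have coord_S: "coord (S y) n = w y n" for y n
    using summ[of y] by (simp add: S_def Abs_ell2_inverse)
  have "bounded_linear S"
  proof (rule bounded_linear_intro[where K = "norm T"])
    fix x y :: ell2 and r :: real
    show "S (x + y) = S x + S y"
      by (rule ell2_eqI) (simp add: coord_S w_def cinner_add_left)
    show "S (r *\<^sub>R x) = r *\<^sub>R S x"
      by (rule ell2_eqI) (simp add: coord_S w_def scaleR_ell2_def cinner_scale_left)
    have "(norm (S x))\<^sup>2 \<le> (norm T * norm x)\<^sup>2"
      unfolding norm_ell2_sq coord_S using summ bound by (intro suminf_le_const) auto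
    then have "norm (S x) \<le> norm T * norm x" by (rule power2_le_imp_le) simp
    then show "norm (S x) \<le> norm x * norm T" by (simp add: mult.commute)
  qed
  then have S: "blinfun_apply (Blinfun S) = S" by (rule bounded_linear_Blinfun_apply)
  have "cinner (blinfun_apply T x) y = cinner x (S y)" for x y
  proof (rule LIMSEQ_unique)
    have "bounded_linear (\<lambda>v. cinner v y)"
      using cinner_Cauchy_Schwarz
      by (intro bounded_linear_intro[where K = "norm y"])
         (auto simp: cinner_add_left scaleR_ell2_def cinner_scale_left scaleR_conv_of_real)
    from bounded_linear.tendsto[OF this
        bounded_linear.tendsto[OF blinfun.bounded_linear_right trunc_tendsto]]
    show "(\<lambda>k. cinner (blinfun_apply T (trunc k (coord x))) y) \<longlonglongrightarrow> cinner (blinfun_apply T x) y" .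
    show "(\<lambda>k. cinner (blinfun_apply T (trunc k (coord x))) y) \<longlonglongrightarrow> cinner x (S y)"
      using cinner_sums[of x "S y"] by (simp add: trunc coord_S sums_def)
  qed
  with S show ?thesis by metis
qed

lemma cinner_adj:
  assumes "T \<in> bounded_operators"
  shows "cinner (blinfun_apply T x) y = cinner x (blinfun_apply (adj T) y)"
proof -
  let ?P = "\<lambda>S. \<forall>x y. cinner (blinfun_apply T x) y = cinner x (blinfun_apply S y)"
  obtain S where S: "?P S" using adjoint_exists[OF assms] by blast
  have "?P (adj T)"
    unfolding adj_def
  proof (rule theI[of ?P, OF S])
    fix R
    assume R: "?P R"
    have "cinner x (blinfun_apply R y) = cinner x (blinfun_apply S y)" for x y
      using R[rule_format, of x y] S[rule_format, of x y] by (rule trans[OF sym])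
    then show "R = S" by (intro blinfun_eqI cinner_ext)
  qed
  then show ?thesis by blast
qed

lemma adj_in_bounded_operators:
  assumes "T \<in> bounded_operators"
  shows "adj T \<in> bounded_operators"
proof -
  have "blinfun_apply (adj T) (scale_vec c y) = scale_vec c (blinfun_apply (adj T) y)" for c y
  proof (rule cinner_ext)
    fix x
    show "cinner x (blinfun_apply (adj T) (scale_vec c y))
        = cinner x (scale_vec c (blinfun_apply (adj T) y))"
      unfolding cinner_adj[OF assms, symmetric] cinner_scale_right ..
  qed
  then show ?thesis by (simp add: bounded_operators_def)
qed


section \<open>The algebras attached to a supernatural number\<close>

text \<open>A supernatural number is given by its exponents; values at non-primes are irrelevant.\<close>

type_synonym supernatural = "nat \<Rightarrow> enat"

definition divides_supernatural :: "nat \<Rightarrow> supernatural \<Rightarrow> bool" where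
  "divides_supernatural j N \<longleftrightarrow> j > 0 \<and> (\<forall>p. prime p \<longrightarrow> enat (multiplicity p j) \<le> N p)"

definition periodic :: "nat \<Rightarrow> (nat \<Rightarrow> complex) \<Rightarrow> bool" where
  "periodic j a \<longleftrightarrow> (\<forall>k. a (k + j) = a k)"

lemma periodic_bounded:
  assumes "periodic j a" "j > 0"
  shows "bounded (range a)"
proof -
  have "a k \<in> a ` {..<j}" for k
  proof (induction k rule: less_induct)
    case (less k)
    show ?case
    proof (cases "k < j")
      case False
      then have "a k = a (k - j)" using assms(1) by (metis periodic_def le_add_diff_inverse2 not_le)
      then show ?thesis using less[of "k - j"] False assms(2) by simp
    qed auto
  qed
  then have "range a \<subseteq> a ` {..<j}" by blast
  then show ?thesis by (meson finite_imp_bounded finite_imageI finite_lessThan finite_subset)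
qed

definition diag_per :: "supernatural \<Rightarrow> oper set" where
  "diag_per N = {diag_op a | a. \<exists>j. divides_supernatural j N \<and> periodic j a}"

definition poly_alg :: "supernatural \<Rightarrow> oper set" where
  "poly_alg N = star_subalgebra hull (insert shift (diag_per N))"

definition cstar_alg :: "supernatural \<Rightarrow> oper set" where
  "cstar_alg N = cstar_subalgebra hull (insert shift (diag_per N))"

text \<open>Values of \<open>d\<close> outside \<open>poly_alg N\<close> are irrelevant.\<close>

definition derivation :: "supernatural \<Rightarrow> (oper \<Rightarrow> oper) \<Rightarrow> bool" where
  "derivation N d \<longleftrightarrow>
     (\<forall>a \<in> poly_alg N. d a \<in> cstar_alg N) \<and>
     (\<forall>a \<in> poly_alg N. \<forall>b \<in> poly_alg N. d (a + b) = d a + d b) \<and>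
     (\<forall>c. \<forall>a \<in> poly_alg N. d (scale_op c a) = scale_op c (d a)) \<and>
     (\<forall>a \<in> poly_alg N. \<forall>b \<in> poly_alg N. d (a o\<^sub>L b) = (d a o\<^sub>L b) + (a o\<^sub>L d b))"

end

theory Submission
  imports Defs
begin

text \<open>Every element of the polynomial algebra has a matrix that is banded and, away from finitely
  many rows and columns, invariant under a diagonal shift. The entries of a compact operator tend to
  zero along diagonals, so a compact \<open>F\<close> in the algebra has only finitely many nonzero rows; that
  is, \<open>F = Q F\<close> for a coordinate projection \<open>Q = 1 - U\<^sup>n (U\<^sup>*)\<^sup>n\<close> in the algebra.
  The Leibniz rule \<open>d F = d Q F + Q d F\<close> then exhibits \<open>d F\<close> as a sum of two compact operators.\<close>

section \<open>Compact operators\<close>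

lemma scale_vec_add: "scale_vec c (x + y) = scale_vec c x + scale_vec c y"
  by (rule ell2_eqI) (simp add: algebra_simps)

lemma scale_vec_scale_vec: "scale_vec c (scale_vec b x) = scale_vec (c * b) x"
  by (rule ell2_eqI) simp

lemma zero_in_bounded_operators: "0 \<in> bounded_operators"
  by (auto simp: bounded_operators_def intro: ell2_eqI)

lemma add_in_bounded_operators:
  "S \<in> bounded_operators \<Longrightarrow> T \<in> bounded_operators \<Longrightarrow> S + T \<in> bounded_operators"
  by (simp add: bounded_operators_def blinfun.add_left scale_vec_add)

lemma scale_op_in_bounded_operators:
  "T \<in> bounded_operators \<Longrightarrow> scale_op c T \<in> bounded_operators"
  by (simp add: bounded_operators_def scale_op_apply scale_vec_scale_vec mult.commute)

lemma compose_in_bounded_operators: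
  "S \<in> bounded_operators \<Longrightarrow> T \<in> bounded_operators \<Longrightarrow> S o\<^sub>L T \<in> bounded_operators"
  by (simp add: bounded_operators_def)

text \<open>Trapping the image of the unit ball in any compact set suffices, since its closure is
  then a closed subset of that set; later proofs need not compute the closure.\<close>

lemma compact_operatorsI:
  assumes "T \<in> bounded_operators" "compact C" "\<And>x. norm x \<le> 1 \<Longrightarrow> blinfun_apply T x \<in> C"
  shows "T \<in> compact_operators"
proof -
  have "closure (blinfun_apply T ` cball 0 1) \<subseteq> C"
    using assms by (intro closure_minimal compact_imp_closed) auto
  with assms show ?thesis
    unfolding compact_operators_def
    using closed_Int_compact[OF closed_closure[of "blinfun_apply T ` cball 0 1"] assms(2)]
    by (simp add: inf.absorb1)
qed

lemma compact_operatorsE: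
  assumes "T \<in> compact_operators"
  obtains C where "compact C" "\<And>x. norm x \<le> 1 \<Longrightarrow> blinfun_apply T x \<in> C"
proof
  show "compact (closure (blinfun_apply T ` cball 0 1))"
    using assms by (simp add: compact_operators_def)
  show "blinfun_apply T x \<in> closure (blinfun_apply T ` cball 0 1)" if "norm x \<le> 1" for x
    using that closure_subset by fastforce
qed

lemma compact_operators_bounded: "T \<in> compact_operators \<Longrightarrow> T \<in> bounded_operators"
  by (simp add: compact_operators_def)

lemma compact_operators_add:
  assumes "S \<in> compact_operators" "T \<in> compact_operators"
  shows "S + T \<in> compact_operators"
proof -
  obtain C where C: "compact C" "\<And>x. norm x \<le> 1 \<Longrightarrow> blinfun_apply S x \<in> C"
    by (rule compact_operatorsE[OF assms(1)]) blast
  obtain D where D: "compact D" "\<And>x. norm x \<le> 1 \<Longrightarrow> blinfun_apply T x \<in> D"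
    by (rule compact_operatorsE[OF assms(2)]) blast
  show ?thesis
  proof (rule compact_operatorsI)
    show "S + T \<in> bounded_operators"
      using assms by (simp add: compact_operators_bounded add_in_bounded_operators)
    show "compact {x + y | x y. x \<in> C \<and> y \<in> D}"
      using C D by (intro compact_sums)
  qed (use C D in \<open>auto simp: blinfun.add_left\<close>)
qed

lemma compact_operators_compose_left:
  assumes "S \<in> bounded_operators" "T \<in> compact_operators"
  shows "S o\<^sub>L T \<in> compact_operators"
proof -
  obtain C where C: "compact C" "\<And>x. norm x \<le> 1 \<Longrightarrow> blinfun_apply T x \<in> C"
    by (rule compact_operatorsE[OF assms(2)]) blast
  show ?thesis
  proof (rule compact_operatorsI)
    show "S o\<^sub>L T \<in> bounded_operators"
      using assms by (simp add: compact_operators_bounded compose_in_bounded_operators)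
    show "compact (blinfun_apply S ` C)"
      using C by (intro compact_continuous_image continuous_intros)
  qed (use C in auto)
qed

lemma compact_operators_compose_right:
  assumes "S \<in> compact_operators" "T \<in> bounded_operators"
  shows "S o\<^sub>L T \<in> compact_operators"
proof -
  obtain C where C: "compact C" "\<And>x. norm x \<le> 1 \<Longrightarrow> blinfun_apply S x \<in> C"
    by (rule compact_operatorsE[OF assms(1)]) blast
  \<comment> \<open>\<open>T\<close> maps the unit ball into the ball of radius \<open>r\<close>;
    the added 1 keeps \<open>r\<close> invertible even for \<open>T = 0\<close>.\<close>
  define r where "r = norm T + 1"
  have r: "r > 0" unfolding r_def using norm_ge_zero[of T] by linarith
  show ?thesis
  proof (rule compact_operatorsI)
    show "S o\<^sub>L T \<in> bounded_operators"
      using assms by (simp add: compact_operators_bounded compose_in_bounded_operators)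
    show "compact ((*\<^sub>R) r ` C)"
      using C by (intro compact_scaling)
    fix x :: ell2
    assume x: "norm x \<le> 1"
    have "norm (blinfun_apply T x) \<le> norm T * norm x" by (rule norm_blinfun)
    also have "\<dots> \<le> r"
      using mult_left_mono[OF x norm_ge_zero[of T]] by (simp add: r_def)
    finally have "norm (blinfun_apply T x /\<^sub>R r) \<le> 1"
      using r by (simp add: field_simps)
    then have "blinfun_apply S (blinfun_apply T x /\<^sub>R r) \<in> C" by (rule C)
    moreover have "blinfun_apply (S o\<^sub>L T) x = r *\<^sub>R blinfun_apply S (blinfun_apply T x /\<^sub>R r)"
      using r by (simp add: blinfun.scaleR_right)
    ultimately show "blinfun_apply (S o\<^sub>L T) x \<in> (*\<^sub>R) r ` C" by blast
  qed
qed

section \<open>Matrix entries\<close>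

definition entry :: "oper \<Rightarrow> nat \<Rightarrow> nat \<Rightarrow> complex" where
  "entry T k l = coord (blinfun_apply T (basis_vec l)) k"

lemma entry_adj:
  assumes "T \<in> bounded_operators"
  shows "entry (adj T) k l = cnj (entry T l k)"
  by (metis assms cinner_adj cinner_basis_vec_right cinner_commute entry_def)

text \<open>The conjugated row \<open>k\<close> of \<open>T\<close> is the vector
  \<open>adj T\<close> applied to \<open>basis_vec k\<close>, so the series is that of an inner
  product in \<open>ell2\<close>.\<close>

lemma coord_apply_sums:
  assumes "T \<in> bounded_operators"
  shows "(\<lambda>i. entry T k i * coord x i) sums coord (blinfun_apply T x) k"
proof -
  have "coord (blinfun_apply T x) k = cinner x (blinfun_apply (adj T) (basis_vec k))"
    using cinner_adj[OF assms] cinner_basis_vec_right by metis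
  moreover have "cnj (coord (blinfun_apply (adj T) (basis_vec k)) i) = entry T k i" for i
    using entry_adj[OF assms, of i k] by (simp add: entry_def)
  ultimately show ?thesis
    using cinner_sums[of x "blinfun_apply (adj T) (basis_vec k)"] by (simp add: mult.commute)
qed

lemma norm_basis_vec: "norm (basis_vec k) = 1"
proof -
  have "(\<lambda>n. (cmod (coord (basis_vec k) n))\<^sup>2) = (\<lambda>n. if n = k then 1 else 0)" by auto
  then show ?thesis
    using sums_single[of k "\<lambda>_. 1 :: real"] by (simp add: norm_ell2_def sums_iff)
qed

lemma coord_le_norm: "cmod (coord x k) \<le> norm x"
  using cinner_Cauchy_Schwarz[of x "basis_vec k"]
  by (simp add: cinner_basis_vec_right norm_basis_vec)

lemma coord_tendsto_zero: "coord x \<longlonglongrightarrow> 0"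
proof -
  have "(\<lambda>n. sqrt ((cmod (coord x n))\<^sup>2)) \<longlonglongrightarrow> sqrt 0"
    by (intro tendsto_real_sqrt summable_LIMSEQ_zero summable_coord)
  then show ?thesis by (simp add: tendsto_norm_zero_iff)
qed

text \<open>The images of basis vectors lie in a compact set, so a subsequence converges to some
  \<open>y\<close>. Its coordinates at rows tending to infinity approach those of \<open>y\<close>,
  which tend to 0.\<close>

lemma compact_operator_constant_entries:
  assumes T: "T \<in> compact_operators"
    and k: "filterlim k at_top sequentially"
    and c: "\<And>i. entry T (k i) (l i) = c"
  shows "c = 0"
proof -
  obtain C where C: "compact C" "\<And>x. norm x \<le> 1 \<Longrightarrow> blinfun_apply T x \<in> C"
    by (rule compact_operatorsE[OF T]) blast
  define v where "v i = blinfun_apply T (basis_vec (l i))" for i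
  have "\<forall>i. v i \<in> C" by (simp add: v_def C norm_basis_vec)
  then obtain y r where r: "strict_mono (r :: nat \<Rightarrow> nat)" and y: "(v \<circ> r) \<longlonglongrightarrow> y"
    using C(1) unfolding compact_def by blast
  have "(\<lambda>i. norm (v (r i) - y)) \<longlonglongrightarrow> 0"
    using y by (simp add: LIM_zero tendsto_norm_zero o_def)
  then have 1: "(\<lambda>i. coord (v (r i) - y) (k (r i))) \<longlonglongrightarrow> 0"
    by (rule Lim_null_comparison[OF always_eventually, rotated])
      (simp add: coord_le_norm del: coord_diff)
  have 2: "(\<lambda>i. coord y (k (r i))) \<longlonglongrightarrow> 0"
    by (rule filterlim_compose[OF coord_tendsto_zero
          filterlim_compose[OF k filterlim_subseq[OF r]]])
  have "(\<lambda>i. coord (v (r i)) (k (r i))) \<longlonglongrightarrow> 0"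
    using tendsto_add[OF 1 2] by simp
  then show ?thesis
    using c by (simp add: v_def entry_def LIMSEQ_const_iff)
qed

section \<open>Banded, eventually periodic matrices\<close>

text \<open>Here \<open>m\<close> is the bandwidth, \<open>j\<close> the period along diagonals and
  \<open>n\<close> the index where periodicity starts. The threshold is needed because products such
  as \<open>shift o\<^sub>L adj shift\<close> differ from the identity in the top left
  corner.\<close>

definition band_periodic :: "nat \<Rightarrow> nat \<Rightarrow> nat \<Rightarrow> oper \<Rightarrow> bool" where
  "band_periodic j m n T \<longleftrightarrow>
     (\<forall>k l. k > l + m \<or> l > k + m \<longrightarrow> entry T k l = 0) \<and>
     (\<forall>k l. n \<le> k \<longrightarrow> n \<le> l \<longrightarrow> entry T (k + j) (l + j) = entry T k l)"

lemma band_periodic_zero_entry: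
  "band_periodic j m n T \<Longrightarrow> k > l + m \<or> l > k + m \<Longrightarrow> entry T k l = 0"
  unfolding band_periodic_def by blast

lemma band_periodic_iterate:
  assumes "band_periodic j m n T" "n \<le> k" "n \<le> l"
  shows "entry T (k + i * j) (l + i * j) = entry T k l"
proof (induction i)
  case (Suc i)
  have "entry T ((k + i * j) + j) ((l + i * j) + j) = entry T (k + i * j) (l + i * j)"
    using assms by (simp add: band_periodic_def)
  with Suc show ?case by (simp add: algebra_simps)
qed simp

lemma band_periodic_mono:
  assumes "band_periodic j m n T" "m \<le> m'" "n \<le> n'"
  shows "band_periodic (i * j) m' n' T"
  using band_periodic_iterate[OF assms(1)] assms unfolding band_periodic_def by auto

text \<open>Column \<open>l\<close> of \<open>T\<close> is supported in rows up to
  \<open>l + m\<close>, so the matrix product is a finite sum. The free cutoff \<open>r\<close>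
  allows sums of different lengths to be compared.\<close>

lemma entry_compose:
  assumes S: "S \<in> bounded_operators" and T: "band_periodic j m n T" and "l + m < r"
  shows "entry (S o\<^sub>L T) k l = (\<Sum>i<r. entry S k i * entry T i l)"
proof -
  have "(\<lambda>i. entry S k i * entry T i l) sums (\<Sum>i<r. entry S k i * entry T i l)"
    using assms(3) by (intro sums_finite) (auto intro: band_periodic_zero_entry[OF T])
  moreover have "(\<lambda>i. entry S k i * entry T i l) sums entry (S o\<^sub>L T) k l"
    using coord_apply_sums[OF S, of k "blinfun_apply T (basis_vec l)"] by (simp add: entry_def)
  ultimately show ?thesis by (rule sums_unique2[symmetric])
qed

text \<open>Bandwidths add. In a row \<open>k\<close> past the new threshold, \<open>S\<close> has
  nonzero entries only at intermediate indices beyond \<open>n\<close>, where both factors are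
  periodic.\<close>

lemma band_periodic_compose:
  assumes S: "S \<in> bounded_operators"
    and bS: "band_periodic j m n S" and bT: "band_periodic j m n T"
  shows "band_periodic j (2 * m) (n + m + 1) (S o\<^sub>L T)"
  unfolding band_periodic_def
proof (intro conjI allI impI)
  fix k l
  assume kl: "k > l + 2 * m \<or> l > k + 2 * m"
  have zero: "entry S k i * entry T i l = 0" for i
  proof (cases "k > i + m \<or> i > k + m")
    case False
    with kl have "i > l + m \<or> l > i + m" by auto
    then show ?thesis using band_periodic_zero_entry[OF bT] by simp
  qed (use band_periodic_zero_entry[OF bS] in simp)
  show "entry (S o\<^sub>L T) k l = 0"
    using entry_compose[OF S bT lessI, of k l] by (simp only: zero sum.neutral_const)
next
  fix k l
  assume k: "n + m + 1 \<le> k" and l: "n + m + 1 \<le> l"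
  let ?f = "\<lambda>i. entry S (k + j) i * entry T i (l + j)"
  \<comment> \<open>Shifting the summation index by \<open>j\<close> leaves these first terms over;
    since \<open>k > m\<close>, they lie outside the band of \<open>S\<close>.\<close>
  have low: "?f i = 0" if "i < j" for i
    using that k by (intro mult_eq_0_iff[THEN iffD2] disjI1 band_periodic_zero_entry[OF bS]) auto
  have high: "?f (i + j) = entry S k i * entry T i l" for i
  proof (cases "i < n")
    case True
    then have "entry S k i = 0" "entry S (k + j) (i + j) = 0"
      using k by (auto intro!: band_periodic_zero_entry[OF bS])
    then show ?thesis by simp
  next
    case False
    then have "entry S (k + j) (i + j) = entry S k i" "entry T (i + j) (l + j) = entry T i l"
      using k l bS bT by (auto simp: band_periodic_def)
    then show ?thesis by simp
  qed
  have split: "(\<Sum>i<j + r. ?f i) = (\<Sum>i<j. ?f i) + (\<Sum>i<r. ?f (i + j))" for r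
    by (induction r) (simp_all add: add_ac)
  have "entry (S o\<^sub>L T) (k + j) (l + j) = (\<Sum>i<j + Suc (l + m). ?f i)"
    by (rule entry_compose[OF S bT]) simp
  also have "\<dots> = (\<Sum>i<j. ?f i) + (\<Sum>i<Suc (l + m). ?f (i + j))"
    by (rule split)
  also have "\<dots> = entry (S o\<^sub>L T) k l"
  proof -
    have "(\<Sum>i<j. ?f i) = 0" using low by (intro sum.neutral) blast
    then show ?thesis by (simp only: high entry_compose[OF S bT lessI] add_0)
  qed
  finally show "entry (S o\<^sub>L T) (k + j) (l + j) = entry (S o\<^sub>L T) k l" .
qed

definition band_periodic_operators :: "oper set" where
  "band_periodic_operators = {T \<in> bounded_operators. \<exists>j m n. j > 0 \<and> band_periodic j m n T}"

text \<open>The product of the periods and the maxima of the bandwidths and thresholds serve both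
  operators.\<close>

lemma band_periodic_common:
  assumes "S \<in> band_periodic_operators" "T \<in> band_periodic_operators"
  obtains j m n where "j > 0" "band_periodic j m n S" "band_periodic j m n T"
proof -
  obtain j m n j' m' n' where h: "j > 0" "band_periodic j m n S" "j' > 0" "band_periodic j' m' n' T"
    using assms by (auto simp: band_periodic_operators_def)
  show thesis
  proof (rule that)
    show "band_periodic (j' * j) (max m m') (max n n') S"
      using h by (auto intro: band_periodic_mono)
    show "band_periodic (j' * j) (max m m') (max n n') T"
      using h band_periodic_mono[of j' m' n' T "max m m'" "max n n'" j] by (simp add: mult.commute)
  qed (use h in simp)
qed

text \<open>Sums, scalar multiples and adjoints keep common parameters, the conditions being
  symmetric in rows and columns; only products enlarge the band and the threshold.\<close>

lemma star_subalgebra_band_periodic: "star_subalgebra band_periodic_operators"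
  unfolding star_subalgebra_def
proof (intro conjI ballI allI)
  show "band_periodic_operators \<subseteq> bounded_operators"
    by (auto simp: band_periodic_operators_def)
  show "0 \<in> band_periodic_operators"
    by (auto simp: band_periodic_operators_def band_periodic_def entry_def
        zero_in_bounded_operators)
next
  fix S T
  assume ST: "S \<in> band_periodic_operators" "T \<in> band_periodic_operators"
  then have b: "S \<in> bounded_operators" "T \<in> bounded_operators"
    by (auto simp: band_periodic_operators_def)
  obtain j m n where h: "j > 0" "band_periodic j m n S" "band_periodic j m n T"
    using band_periodic_common[OF ST] .
  then have "band_periodic j m n (S + T)"
    by (simp add: band_periodic_def entry_def blinfun.add_left)
  then show "S + T \<in> band_periodic_operators"
    using h(1) b by (auto simp: band_periodic_operators_def add_in_bounded_operators)
  show "S o\<^sub>L T \<in> band_periodic_operators"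
    using h(1) b band_periodic_compose[OF b(1) h(2,3)]
    by (auto simp: band_periodic_operators_def compose_in_bounded_operators)
next
  fix T c
  assume "T \<in> band_periodic_operators"
  then obtain j m n where h: "T \<in> bounded_operators" "j > 0" "band_periodic j m n T"
    by (auto simp: band_periodic_operators_def)
  then have "band_periodic j m n (scale_op c T)"
    by (simp add: band_periodic_def entry_def scale_op_apply)
  with h show "scale_op c T \<in> band_periodic_operators"
    by (auto simp: band_periodic_operators_def scale_op_in_bounded_operators)
  from h have "band_periodic j m n (adj T)"
    by (auto simp: band_periodic_def entry_adj)
  with h show "adj T \<in> band_periodic_operators"
    by (auto simp: band_periodic_operators_def adj_in_bounded_operators)
qed

lemma generators_band_periodic: "insert shift (diag_per N) \<subseteq> band_periodic_operators"
proof -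
  have "band_periodic 1 1 0 shift"
    by (auto simp: band_periodic_def entry_def shift_basis_vec)
  then have "shift \<in> band_periodic_operators"
    by (auto simp: band_periodic_operators_def shift_in_bounded_operators)
  moreover have "diag_op a \<in> band_periodic_operators"
    if "divides_supernatural j N" "periodic j a" for a j
  proof -
    have "j > 0" using that by (simp add: divides_supernatural_def)
    moreover have "band_periodic j 0 0 (diag_op a)"
      using that(2) periodic_bounded[OF that(2) \<open>j > 0\<close>]
      by (auto simp: band_periodic_def entry_def diag_op_basis_vec periodic_def)
    ultimately show ?thesis
      by (auto simp: band_periodic_operators_def diag_op_in_bounded_operators)
  qed
  ultimately show ?thesis by (auto simp: diag_per_def)
qed

text \<open>Below row \<open>n + m\<close>, an entry in a column before \<open>n\<close> is outside
  the band. Any other repeats forever down its diagonal, which compactness allows only for the value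
  0.\<close>

lemma compact_band_periodic_rows:
  assumes "T \<in> band_periodic_operators" "T \<in> compact_operators"
  obtains r where "\<And>k l. k \<ge> r \<Longrightarrow> entry T k l = 0"
proof -
  obtain j m n where h: "j > 0" "band_periodic j m n T"
    using assms(1) by (auto simp: band_periodic_operators_def)
  have "entry T k l = 0" if k: "k \<ge> n + m" for k l
  proof (cases "l < n")
    case True
    then show ?thesis using k by (intro band_periodic_zero_entry[OF h(2)]) auto
  next
    case False
    have "strict_mono (\<lambda>i. k + i * j)" using h(1) by (intro strict_monoI) simp
    then show ?thesis
      using compact_operator_constant_entries[OF assms(2), of "\<lambda>i. k + i * j" "\<lambda>i. l + i * j"]
        band_periodic_iterate[OF h(2)] k False by (simp add: filterlim_subseq)
  qed
  then show thesis by (rule that)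
qed

section \<open>The generated algebras\<close>

lemma star_subalgebra_bounded_operators: "star_subalgebra bounded_operators"
  by (simp add: star_subalgebra_def zero_in_bounded_operators add_in_bounded_operators
      scale_op_in_bounded_operators compose_in_bounded_operators adj_in_bounded_operators)

lemma closed_bounded_operators: "closed bounded_operators"
proof -
  have "continuous_on UNIV (\<lambda>T. blinfun_apply T (scale_vec c x))"
    "continuous_on UNIV (\<lambda>T. scale_vec c (blinfun_apply T x))" for c x
    by (intro continuous_intros linear_continuous_on blinfun.bounded_linear_left
        bounded_linear_compose[OF bounded_linear_scale_vec])+
  then show ?thesis
    unfolding bounded_operators_def
    by (intro closed_Collect_all closed_Collect_eq) auto
qed

lemma generators_bounded: "insert shift (diag_per N) \<subseteq> bounded_operators"
  by (auto simp: diag_per_def shift_in_bounded_operators diag_op_in_bounded_operators)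

text \<open>This makes the values of a derivation complex-linear, as the composition lemmas for
  compact operators require.\<close>

lemma cstar_alg_bounded: "cstar_alg N \<subseteq> bounded_operators"
  unfolding cstar_alg_def
  by (rule hull_minimal[OF generators_bounded])
    (simp add: cstar_subalgebra_def star_subalgebra_bounded_operators closed_bounded_operators)

lemma poly_alg_band_periodic: "poly_alg N \<subseteq> band_periodic_operators"
  unfolding poly_alg_def
  by (intro hull_minimal generators_band_periodic star_subalgebra_band_periodic)

lemma star_subalgebra_poly_alg: "star_subalgebra (poly_alg N)"
proof -
  \<comment> \<open>The closure conditions pass to any intersection, but this inclusion needs at
    least one star subalgebra containing the generators.\<close>
  have "poly_alg N \<subseteq> bounded_operators"
    unfolding poly_alg_def
    by (intro hull_minimal generators_bounded star_subalgebra_bounded_operators)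
  then show ?thesis
    unfolding star_subalgebra_def poly_alg_def hull_def by blast
qed

lemma generators_in_poly_alg: "insert shift (diag_per N) \<subseteq> poly_alg N"
  unfolding poly_alg_def by (rule hull_subset)

section \<open>Coordinate projections\<close>

definition coord_proj :: "nat \<Rightarrow> oper" where
  "coord_proj n = diag_op (\<lambda>k. if k < n then 1 else 0)"

lemma coord_coord_proj: "coord (blinfun_apply (coord_proj n) x) k = (if k < n then coord x k else 0)"
proof -
  have "finite (range (\<lambda>k. if k < n then 1 else 0 :: complex))"
    by (rule finite_subset[of _ "{0, 1}"]) auto
  then show ?thesis
    by (simp add: coord_proj_def diag_op.rep_eq coord_diag_vec finite_imp_bounded)
qed

lemma coord_proj_apply: "blinfun_apply (coord_proj n) x = trunc n (coord x)"
  by (rule ell2_eqI) (simp add: coord_coord_proj)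

lemma coord_adj_shift: "coord (blinfun_apply (adj shift) x) k = coord x (Suc k)"
  by (metis cinner_adj cinner_basis_vec_right cinner_commute shift_basis_vec
      shift_in_bounded_operators)

text \<open>For \<open>n > 0\<close> the defining sequence is not periodic, so the projection is
  built from the shift and the identity, which is 1-periodic with 1 dividing every
  \<open>N\<close>.\<close>

lemma coord_proj_in_poly_alg: "coord_proj n \<in> poly_alg N"
proof -
  have alg: "S + T \<in> poly_alg N" "scale_op c S \<in> poly_alg N" "S o\<^sub>L T \<in> poly_alg N"
    "adj S \<in> poly_alg N" if "S \<in> poly_alg N" "T \<in> poly_alg N" for S T c
    using star_subalgebra_poly_alg[of N] that by (simp_all add: star_subalgebra_def)
  define I where "I = diag_op (\<lambda>_. 1)"
  have coord_I: "coord (blinfun_apply I x) k = coord x k" for x k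
    by (simp add: I_def diag_op.rep_eq coord_diag_vec image_constant_conv)
  have "I \<in> diag_per N"
    by (auto simp: I_def diag_per_def periodic_def divides_supernatural_def
        zero_enat_def[symmetric] intro!: exI[of _ "\<lambda>_. 1"] exI[of _ 1])
  then have I: "I \<in> poly_alg N" and U: "shift \<in> poly_alg N"
    using generators_in_poly_alg by auto
  show ?thesis
  proof (induction n)
    case 0
    have "coord_proj 0 = 0"
      by (intro blinfun_eqI ell2_eqI) (simp add: coord_coord_proj)
    then show ?case using star_subalgebra_poly_alg by (simp add: star_subalgebra_def)
  next
    case (Suc n)
    \<comment> \<open>Conjugation by the shift turns the projection onto coordinates from
      \<open>n\<close> on into the one onto coordinates from \<open>Suc n\<close> on.\<close>
    have "coord_proj (Suc n) =
        I + scale_op (-1) (shift o\<^sub>L ((I + scale_op (-1) (coord_proj n)) o\<^sub>L adj shift))"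
      by (intro blinfun_eqI ell2_eqI)
        (auto simp: coord_coord_proj coord_I blinfun.add_left scale_op_apply shift.rep_eq
          coord_shift_vec coord_adj_shift split: nat.split)
    then show ?case using alg I U Suc by simp
  qed
qed

text \<open>Each further coordinate of a vector in the unit ball ranges over a closed disc, so the
  compact set grows by a Minkowski sum with a compact disc.\<close>

lemma coord_proj_compact: "coord_proj n \<in> compact_operators"
proof -
  have "\<exists>C. compact C \<and> (\<forall>x. norm x \<le> 1 \<longrightarrow> trunc n (coord x) \<in> C)"
  proof (induction n)
    case 0
    have "trunc 0 (coord x) = 0" for x by (rule ell2_eqI) simp
    then show ?case by (intro exI[of _ "{0}"]) auto
  next
    case (Suc n)
    then obtain C where C: "compact C" "\<And>x. norm x \<le> 1 \<Longrightarrow> trunc n (coord x) \<in> C" by blast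
    define D where "D = (\<lambda>c. scale_vec c (basis_vec n)) ` cball 0 1"
    have "bounded_linear (\<lambda>c. scale_vec c (basis_vec n))"
      by (rule bounded_linear_intro[where K = 1])
        (auto intro!: ell2_eqI simp: algebra_simps norm_scale_vec norm_basis_vec scaleR_conv_of_real)
    then have "compact D"
      unfolding D_def by (intro compact_continuous_image linear_continuous_on compact_cball)
    then have "compact {x + y | x y. x \<in> C \<and> y \<in> D}"
      using C by (intro compact_sums)
    moreover have "trunc (Suc n) (coord x) \<in> {x + y | x y. x \<in> C \<and> y \<in> D}"
      if "norm x \<le> 1" for x
    proof -
      have "scale_vec (coord x n) (basis_vec n) \<in> D"
        unfolding D_def using order_trans[OF coord_le_norm that] by (intro imageI) simp
      then show ?thesis using C(2)[OF that] unfolding trunc_Suc by blast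
    qed
    ultimately show ?case by blast
  qed
  then obtain C where C: "compact C" "\<And>x. norm x \<le> 1 \<Longrightarrow> trunc n (coord x) \<in> C" by blast
  have "coord_proj n \<in> bounded_operators"
    by (simp add: coord_proj_def diag_op_in_bounded_operators)
  then show ?thesis
    using C(1) by (rule compact_operatorsI) (simp add: coord_proj_apply C(2))
qed

lemma coord_proj_compose_eq:
  assumes "T \<in> bounded_operators" "\<And>k l. k \<ge> n \<Longrightarrow> entry T k l = 0"
  shows "coord_proj n o\<^sub>L T = T"
proof (intro blinfun_eqI ell2_eqI)
  fix x k
  have "coord (blinfun_apply T x) k = 0" if "k \<ge> n"
    using coord_apply_sums[OF assms(1), of k x] assms(2)[OF that] by (simp add: sums_iff)
  then show "coord (blinfun_apply (coord_proj n o\<^sub>L T) x) k = coord (blinfun_apply T x) k"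
    by (simp add: coord_coord_proj)
qed

theorem theorem3p1:
  fixes N :: supernatural and d :: "oper \<Rightarrow> oper"
  assumes "derivation N d"
  shows "d ` (poly_alg N \<inter> compact_operators) \<subseteq> compact_operators"
proof (intro image_subsetI)
  fix F
  assume "F \<in> poly_alg N \<inter> compact_operators"
  then have F: "F \<in> poly_alg N" "F \<in> compact_operators" by auto
  obtain n where "\<And>k l. k \<ge> n \<Longrightarrow> entry F k l = 0"
    using compact_band_periodic_rows[OF _ F(2)] F(1) poly_alg_band_periodic by blast
  then have QF: "coord_proj n o\<^sub>L F = F"
    by (intro coord_proj_compose_eq compact_operators_bounded F)
  note Q = coord_proj_in_poly_alg[of n N]
  have bounded: "d T \<in> bounded_operators" if "T \<in> poly_alg N" for T
    using assms that cstar_alg_bounded by (auto simp: derivation_def)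
  \<comment> \<open>Both factors lie in \<open>poly_alg N\<close>, so the Leibniz rule applies; each
    summand then has a compact factor, \<open>F\<close> or \<open>coord_proj n\<close>.\<close>
  have "d (coord_proj n o\<^sub>L F) = (d (coord_proj n) o\<^sub>L F) + (coord_proj n o\<^sub>L d F)"
    using assms Q F(1) by (simp add: derivation_def)
  then have "d F = (d (coord_proj n) o\<^sub>L F) + (coord_proj n o\<^sub>L d F)"
    by (simp add: QF)
  then show "d F \<in> compact_operators"
    using compact_operators_add[OF compact_operators_compose_left[OF bounded[OF Q] F(2)]
        compact_operators_compose_right[OF coord_proj_compact bounded[OF F(1)]]] by metis
qed

end
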